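(* Let $A,B,C,D\in\mathbb{C}^{n\times n}$ and $M=\begin{pmatrix}A&B\\C&D\end{pmatrix}$. Suppose that the group inverses $A^{\#}$ and $D^{\#}$ exist, and let $P=pppt(M,A)_{\#}$ and $Q=cpppt(M,D)_{\#}$. (i) If $R(B)\subseteq R(A)$ and $R(C^* )\subseteq R(A^* )$, then $pppt(P,A^{\#})_{\#}=M$. (ii) If $R(C)\subseteq R(D)$ and $R(B^* )\subseteq R(D^* )$, then $cpppt(Q,D^{\#})_{\#}=M$.
   Context: For a square complex matrix $T$, the group inverse $T^{\#}$ (if it exists) is the unique matrix $X$ with $TXT=T$, $XTX=X$ and $TX=XT$. $R(T)$ denotes the range (column space) of $T$ and $T^*$ the conjugate transpose of $T$. For a block matrix $M=\begin{pmatrix}A&B\\C&D\end{pmatrix}$ with $n\times n$ complex blocks such that $A^{\#}$ exists, the pseudo principal pivot transform of $M$ relative to its top left block $A$ is $$pppt(M,A)_{\#}=\begin{pmatrix}A^{\#} & -A^{\#}B\\ CA^{\#} & D-CA^{\#}B\end{pmatrix}.$$ If $D^{\#}$ exists, the complementary pseudo principal pivot transform of $M$ relative to its bottom right block $D$ is $$cpppt(M,D)_{\#}=\begin{pmatrix}A-BD^{\#}C & BD^{\#}\\ -D^{\#}C & D^{\#}\end{pmatrix}.$$ In $pppt(P,A^{\#})_{\#}$ the same construction is applied to the block matrix $P$, whose top left block is $A^{\#}$; in $cpppt(Q,D^{\#})_{\#}$ it is applied to the block matrix $Q$, whose bottom right block is $D^{\#}$. *)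

theory Defs
  imports "Jordan_Normal_Form.Schur_Decomposition" "Jordan_Normal_Form.VS_Connect"
begin

definition is_group_inverse :: "complex mat \<Rightarrow> complex mat \<Rightarrow> bool" where
  "is_group_inverse T X \<longleftrightarrow>
     square_mat T \<and> X \<in> carrier_mat (dim_row T) (dim_row T) \<and>
     T * X * T = T \<and> X * T * X = X \<and> T * X = X * T"

definition has_group_inverse :: "complex mat \<Rightarrow> bool" where
  "has_group_inverse T \<longleftrightarrow> (\<exists>X. is_group_inverse T X)"

text \<open>The value is meaningful only if the group inverse exists;
  it is then unique by \<open>is_group_inverse_unique\<close> below.\<close>

definition group_inverse :: "complex mat \<Rightarrow> complex mat"
  (\<open>(\<open>notation=\<open>postfix group inverse\<close>\<close>_\<^sup>#)\<close> [1000] 999) where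
  "T\<^sup># = (THE X. is_group_inverse T X)"

lemma is_group_inverse_unique:
  assumes "is_group_inverse T X" and "is_group_inverse T Y"
  shows "X = Y"
proof -
  define n where "n = dim_row T"
  have T: "T \<in> carrier_mat n n" and X: "X \<in> carrier_mat n n" and Y: "Y \<in> carrier_mat n n"
    and x: "T * X * T = T" "X * T * X = X" "T * X = X * T"
    and y: "T * Y * T = T" "Y * T * Y = Y" "T * Y = Y * T"
    using assms by (auto simp: is_group_inverse_def n_def)
  have "X * T = X * (T * Y * T)" by (simp add: y(1))
  also have "\<dots> = X * (T * (Y * T))"
    using assoc_mult_mat[OF T Y T] by simp
  also have "\<dots> = X * (T * (T * Y))" by (simp add: y(3))
  also have "\<dots> = X * T * (T * Y)"
    using assoc_mult_mat[OF X T mult_carrier_mat[OF T Y]] by simp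
  also have "\<dots> = T * X * (T * Y)" by (simp add: x(3))
  also have "\<dots> = T * X * T * Y"
    using assoc_mult_mat[OF mult_carrier_mat[OF T X] T Y] by simp
  also have "\<dots> = T * Y" by (simp add: x(1))
  finally have E: "X * T = T * Y" .
  have "X = X * (T * X)"
    using assoc_mult_mat[OF X T X] x(2) by simp
  also have "\<dots> = X * (T * Y)" using E x(3) by simp
  also have "\<dots> = X * T * Y" using assoc_mult_mat[OF X T Y] by simp
  also have "\<dots> = Y * T * Y" using E y(3) by simp
  finally show ?thesis using y(2) by simp
qed

text \<open>The argument \<open>n\<close> is the order of the top left block, so \<open>pppt n M\<close> is the
  transform of \<open>M\<close> relative to its top left \<open>n \<times> n\<close> block, and \<open>cpppt n M\<close> is the
  transform relative to the complementary bottom right block. In both cases the blocks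
  are read off from \<open>M\<close>; the block relative to which the transform is taken is
  assumed to have a group inverse.\<close>

definition pppt :: "nat \<Rightarrow> complex mat \<Rightarrow> complex mat" where
  "pppt n M = (case split_block M n n of (A, B, C, D) \<Rightarrow>
     four_block_mat (A\<^sup>#) (- (A\<^sup># * B)) (C * A\<^sup>#) (D - C * A\<^sup># * B))"

definition cpppt :: "nat \<Rightarrow> complex mat \<Rightarrow> complex mat" where
  "cpppt n M = (case split_block M n n of (A, B, C, D) \<Rightarrow>
     four_block_mat (A - B * D\<^sup># * C) (B * D\<^sup>#) (- (D\<^sup># * C)) (D\<^sup>#))"

end

theory Submission
  imports Defs
begin

text \<open>The range of \<open>B\<close> lies in the range of \<open>A\<close> exactly when \<open>B\<close> is fixed by the
  projector \<open>A * A\<^sup>#\<close>, and dually \<open>R(C\<^sup>*) \<subseteq> R(A\<^sup>*)\<close> gives \<open>C * A\<^sup># * A = C\<close>. With these two identities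
  and \<open>(A\<^sup>#)\<^sup># = A\<close>, the second transform undoes the first block by block.\<close>

lemma dim_mat_adjoint [simp]:
  "dim_row (mat_adjoint A) = dim_col A" "dim_col (mat_adjoint A) = dim_row A"
  by (simp_all add: mat_adjoint_def)

lemma mat_adjoint_carrier: "A \<in> carrier_mat nr nc \<Longrightarrow> mat_adjoint A \<in> carrier_mat nc nr"
  by auto

lemma index_mat_adjoint [simp]:
  assumes "i < dim_col A" and "j < dim_row A"
  shows "mat_adjoint A $$ (i, j) = conjugate (A $$ (j, i))"
  using assms by (simp add: mat_adjoint_def mat_of_rows_def)

lemma mat_adjoint_adjoint:
  fixes A :: "complex mat"
  shows "mat_adjoint (mat_adjoint A) = A"
  by (rule eq_matI) auto

lemma mat_adjoint_mult:
  fixes A B :: "complex mat"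
  assumes "A \<in> carrier_mat nr n" and "B \<in> carrier_mat n nc"
  shows "mat_adjoint (A * B) = mat_adjoint B * mat_adjoint A"
  using assms by (intro eq_matI) (auto simp: scalar_prod_def mult.commute)

text \<open>\<open>A * X\<close> acts as the identity on the range of \<open>A\<close>, because
  \<open>A * X\<close> maps \<open>A *\<^sub>v x\<close> to \<open>A * X * A *\<^sub>v x\<close>.
  Each column of \<open>B\<close> is such a vector.\<close>

lemma mult_inner_inverse_fixes_col_space:
  fixes A B X :: "'a :: field mat"
  assumes A: "A \<in> carrier_mat n m" and X: "X \<in> carrier_mat m n" and B: "B \<in> carrier_mat n k"
    and inner: "A * X * A = A"
    and sub: "vec_space.col_space n B \<subseteq> vec_space.col_space n A"
  shows "A * X * B = B"
proof (rule mat_col_eqI)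
  fix j assume "j < dim_col B"
  \<comment> \<open>A column is the image of a unit vector, and the column space is the set of all
    images.\<close>
  then have "col B j \<in> vec_space.col_space n B"
    using vec_space.col_space_eq[OF B] B unit_vec_carrier[of k j]
    by (auto intro!: bexI[of _ "unit_vec k j"])
  then obtain x where x: "x \<in> carrier_vec m" "A *\<^sub>v x = col B j"
    using sub vec_space.col_space_eq[OF A] A by auto
  have "col (A * X * B) j = (A * X) *\<^sub>v (A *\<^sub>v x)"
    using col_mult2[OF mult_carrier_mat[OF A X] B] \<open>j < dim_col B\<close> B x(2) by simp
  also have "\<dots> = (A * X * A) *\<^sub>v x"
    using A X x(1) by (metis assoc_mult_mat_vec mult_carrier_mat)
  finally show "col (A * X * B) j = col B j" using inner x by simp
qed (use A B in auto)

text \<open>Dual of the preceding result: the adjoint of \<open>X\<close> is an inner inverse of the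
  adjoint of \<open>A\<close>, so that result fixes the adjoint of \<open>C\<close>, and a second
  adjoint returns to \<open>C\<close>.\<close>

lemma mult_inner_inverse_fixes_adjoint_col_space:
  fixes A C X :: "complex mat"
  assumes A: "A \<in> carrier_mat n m" and X: "X \<in> carrier_mat m n" and C: "C \<in> carrier_mat k m"
    and inner: "A * X * A = A"
    and sub: "vec_space.col_space m (mat_adjoint C) \<subseteq> vec_space.col_space m (mat_adjoint A)"
  shows "C * X * A = C"
proof -
  \<comment> \<open>Kept general in \<open>E\<close> for two uses: \<open>E = A\<close> transports
    the inner inverse identity, \<open>E = C\<close> the conclusion.\<close>
  have adjoint_triple: "mat_adjoint A * mat_adjoint X * mat_adjoint E = mat_adjoint (E * X * A)"
    if "E \<in> carrier_mat l m" for E l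
    using mat_adjoint_mult[OF mult_carrier_mat[OF that X] A] mat_adjoint_mult[OF that X]
      assoc_mult_mat[OF mat_adjoint_carrier[OF A] mat_adjoint_carrier[OF X] mat_adjoint_carrier[OF that]]
    by simp
  have "mat_adjoint (C * X * A) = mat_adjoint C"
    using mult_inner_inverse_fixes_col_space[OF mat_adjoint_carrier[OF A] mat_adjoint_carrier[OF X]
        mat_adjoint_carrier[OF C] _ sub]
      adjoint_triple[OF A] adjoint_triple[OF C] inner by simp
  then show ?thesis by (metis mat_adjoint_adjoint)
qed

lemma group_inverse_eqI: "is_group_inverse T X \<Longrightarrow> T\<^sup># = X"
  unfolding group_inverse_def by (blast intro: is_group_inverse_unique)

lemma is_group_inverse_group_inverse: "has_group_inverse T \<Longrightarrow> is_group_inverse T (T\<^sup>#)"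
  using group_inverse_eqI unfolding has_group_inverse_def by blast

lemma is_group_inverse_sym: "is_group_inverse T X \<Longrightarrow> is_group_inverse X T"
  by (auto simp: is_group_inverse_def)

text \<open>The defining equations are symmetric in the two matrices. This returns the pivot block
  to its original value and makes it the factor in the other blocks of the second transform.\<close>

lemma group_inverse_group_inverse: "has_group_inverse T \<Longrightarrow> (T\<^sup>#)\<^sup># = T"
  by (blast intro: group_inverse_eqI is_group_inverse_sym is_group_inverse_group_inverse)

lemma split_block_four_block_mat:
  assumes "A \<in> carrier_mat nr1 nc1" and "B \<in> carrier_mat nr1 nc2"
    and "C \<in> carrier_mat nr2 nc1" and "D \<in> carrier_mat nr2 nc2"
  shows "split_block (four_block_mat A B C D) nr1 nc1 = (A, B, C, D)"
  using assms by (auto simp: split_block_def Let_def)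

lemma pppt_four_block_mat:
  assumes "A \<in> carrier_mat n n" and "B \<in> carrier_mat n m"
    and "C \<in> carrier_mat l n" and "D \<in> carrier_mat l m"
  shows "pppt n (four_block_mat A B C D) =
    four_block_mat (A\<^sup>#) (- (A\<^sup># * B)) (C * A\<^sup>#) (D - C * A\<^sup># * B)"
  by (simp add: pppt_def split_block_four_block_mat[OF assms])

lemma cpppt_four_block_mat:
  assumes "A \<in> carrier_mat n n" and "B \<in> carrier_mat n m"
    and "C \<in> carrier_mat l n" and "D \<in> carrier_mat l m"
  shows "cpppt n (four_block_mat A B C D) =
    four_block_mat (A - B * D\<^sup># * C) (B * D\<^sup>#) (- (D\<^sup># * C)) (D\<^sup>#)"
  by (simp add: cpppt_def split_block_four_block_mat[OF assms])

text \<open>The Schur complement returns to its original value: with \<open>C * X * A = C\<close>, subtracting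
  \<open>(C * X) * A * (- (X * B))\<close> adds back \<open>C * X * B\<close>.\<close>

lemma schur_complement_restore:
  fixes A B C D X :: "'a :: comm_ring_1 mat"
  assumes A: "A \<in> carrier_mat n n" and X: "X \<in> carrier_mat n n"
    and B: "B \<in> carrier_mat n m" and C: "C \<in> carrier_mat l n" and D: "D \<in> carrier_mat l m"
    and fix_C: "C * X * A = C"
  shows "D - C * X * B - C * X * A * - (X * B) = D"
proof -
  have "C * X * A * - (X * B) = - (C * X * B)"
    using fix_C A X B C by (simp add: assoc_mult_mat[of _ l n _ n _ m])
  then show ?thesis using D X B C by (intro eq_matI) auto
qed

lemma pppt_pppt:
  assumes A: "A \<in> carrier_mat n n" and B: "B \<in> carrier_mat n m"
    and C: "C \<in> carrier_mat l n" and D: "D \<in> carrier_mat l m"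
    and inv: "has_group_inverse A"
    and sub_B: "vec_space.col_space n B \<subseteq> vec_space.col_space n A"
    and sub_C: "vec_space.col_space n (mat_adjoint C) \<subseteq> vec_space.col_space n (mat_adjoint A)"
  shows "pppt n (pppt n (four_block_mat A B C D)) = four_block_mat A B C D"
proof -
  let ?X = "A\<^sup>#"
  have X: "?X \<in> carrier_mat n n" and inner: "A * ?X * A = A"
    using is_group_inverse_group_inverse[OF inv] A by (auto simp: is_group_inverse_def)
  have fix_B: "A * (?X * B) = B"
    using mult_inner_inverse_fixes_col_space[OF A X B inner sub_B]
      assoc_mult_mat[OF A X B] by simp
  have fix_C: "C * ?X * A = C"
    using mult_inner_inverse_fixes_adjoint_col_space[OF A X C inner sub_C] .
  have XB: "- (?X * B) \<in> carrier_mat n m" and CX: "C * ?X \<in> carrier_mat l n"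
    and S: "D - C * ?X * B \<in> carrier_mat l m"
    using X B C D by auto
  \<comment> \<open>Top right block of the second transform: the two signs cancel, and the range
    condition on \<open>B\<close> does the rest.\<close>
  have "- (A * - (?X * B)) = B"
    using fix_B A X B by (intro eq_matI) auto
  then show ?thesis
    \<comment> \<open>Since \<open>fix_C\<close> also rewrites inside the Schur complement of the
      goal, the restoring identity is first brought to the same form.\<close>
    by (simp only: pppt_four_block_mat[OF A B C D] pppt_four_block_mat[OF X XB CX S]
        group_inverse_group_inverse[OF inv] fix_C schur_complement_restore[OF A X B C D fix_C,
          unfolded fix_C])
qed

text \<open>Mirror image, with \<open>A\<close> and \<open>D\<close> exchanged and \<open>B\<close>
  and \<open>C\<close> exchanged. The splitting index is still the order \<open>n\<close> of
  \<open>A\<close>, while the ranges compared lie in dimension \<open>m\<close>, the order of the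
  pivot \<open>D\<close>.\<close>

lemma cpppt_cpppt:
  assumes A: "A \<in> carrier_mat n n" and B: "B \<in> carrier_mat n m"
    and C: "C \<in> carrier_mat m n" and D: "D \<in> carrier_mat m m"
    and inv: "has_group_inverse D"
    and sub_C: "vec_space.col_space m C \<subseteq> vec_space.col_space m D"
    and sub_B: "vec_space.col_space m (mat_adjoint B) \<subseteq> vec_space.col_space m (mat_adjoint D)"
  shows "cpppt n (cpppt n (four_block_mat A B C D)) = four_block_mat A B C D"
proof -
  let ?X = "D\<^sup>#"
  have X: "?X \<in> carrier_mat m m" and inner: "D * ?X * D = D"
    using is_group_inverse_group_inverse[OF inv] D by (auto simp: is_group_inverse_def)
  have fix_C: "D * (?X * C) = C"
    using mult_inner_inverse_fixes_col_space[OF D X C inner sub_C]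
      assoc_mult_mat[OF D X C] by simp
  have fix_B: "B * ?X * D = B"
    using mult_inner_inverse_fixes_adjoint_col_space[OF D X B inner sub_B] .
  have XC: "- (?X * C) \<in> carrier_mat m n" and BX: "B * ?X \<in> carrier_mat n m"
    and S: "A - B * ?X * C \<in> carrier_mat n n"
    using X B C A by auto
  \<comment> \<open>Here the signs cancel in the bottom left block; the Schur complement to restore
    is the top left one.\<close>
  have "- (D * - (?X * C)) = C"
    using fix_C D X C by (intro eq_matI) auto
  then show ?thesis
    by (simp only: cpppt_four_block_mat[OF A B C D] cpppt_four_block_mat[OF S BX XC X]
        group_inverse_group_inverse[OF inv] fix_B schur_complement_restore[OF D X C B A fix_B,
          unfolded fix_B])
qed

theorem lemma2p1:
  fixes n :: nat and A B C D M P Q :: "complex mat"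
  assumes "A \<in> carrier_mat n n" and "B \<in> carrier_mat n n"
    and "C \<in> carrier_mat n n" and "D \<in> carrier_mat n n"
    and "M = four_block_mat A B C D"
    and "has_group_inverse A" and "has_group_inverse D"
    and "P = pppt n M" and "Q = cpppt n M"
  shows
    "(vec_space.col_space n B \<subseteq> vec_space.col_space n A \<and>
      vec_space.col_space n (mat_adjoint C) \<subseteq> vec_space.col_space n (mat_adjoint A)
        \<longrightarrow> pppt n P = M) \<and>
     (vec_space.col_space n C \<subseteq> vec_space.col_space n D \<and>
      vec_space.col_space n (mat_adjoint B) \<subseteq> vec_space.col_space n (mat_adjoint D)
        \<longrightarrow> cpppt n Q = M)"
  using pppt_pppt[OF assms(1-4) assms(6)] cpppt_cpppt[OF assms(1-4) assms(7)]
  unfolding assms(5,8,9) by (intro conjI impI; elim conjE)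

end
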